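(* Let $X$ and $Y$ be reflexive and strictly convex real Banach spaces and let $A\colon X\to Y$ be a bounded linear operator such that the metric projection $\pi_{\mathcal N(A)}$ is linear. Suppose the initial mapping $X_0\colon Y\to X$ is homogeneous and satisfies the Smallness condition. Then each of the following sequences $(X_k)_{k\ge0}$ is a sequential regularization: (i) (Schulz-Newton) $X_{k+1}y=X_ky+X_kR_ky$, $y\in Y$, $k=0,1,2,\dots$; (ii) (Landweber) $X_{k+1}y=X_ky+\mu BR_ky$, $y\in Y$, $k=0,1,2,\dots$, where $\mu>0$, $B=J_X^{-1}A'J_Y$ and $X_0=\mu B$. Here $R_ky=\pi_{\overline{\mathcal R(A)}}y-AX_ky$ for $y\in Y$.
   Context: $\mathcal N(A)$ and $\mathcal R(A)$ are the null-space and the (not necessarily closed) range of $A$. For a closed linear subspace $U$ of a reflexive strictly convex Banach space $Z$, the metric projection $\pi_U\colon Z\to U$ maps $z$ to the unique element of $U$ with $\|z-\pi_U(z)\|=\inf_{u\in U}\|z-u\|$. The duality map is $J_X(x)=\{x'\in X':\langle x',x\rangle=\|x\|_X^2=\|x'\|_{X'}^2\}$, similarly $J_Y$; the duality maps and their inverses are taken to be single-valued. $A'\colon Y'\to X'$ is the dual operator of $A$. A mapping is homogeneous if it commutes with multiplication by all real scalars. Smallness condition for $X_0$: (1) (a) $\pi_{\mathcal N(A)}X_0y=0$ for all $y\in Y$, and (b) $X_0\pi_{\overline{\mathcal R(A)}}y=X_0y$ for all $y\in Y$; (2) there is $0<q<1$ such that for all $x\in X$ with $\|x\|_X\le1$ and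 all $y\in Y$ with $\|y\|_Y\le1$: $\|(I_X-\pi_{\mathcal N(A)}-X_0A)x\|_X\le q$ and $\|(\pi_{\overline{\mathcal R(A)}}-AX_0)y\|_Y\le q$. Metric generalized inverse: put $C_X(A)=\{x\in X:J_X(x)\in\mathcal N(A)^\perp\}$ and $C_Y(A)=\{y\in Y:J_Y(y)\in\mathcal R(A)^\perp\}$ (annihilators in the dual spaces). Then $A$ maps $C_X(A)$ injectively onto $\mathcal R(A)$; $\mathcal D(A^\dagger)=\mathcal R(A)+C_Y(A)=\{y\in Y:\pi_{\overline{\mathcal R(A)}}y\in\mathcal R(A)\}$ and $A^\dagger y=(A|_{C_X(A)})^{-1}(\pi_{\overline{\mathcal R(A)}}y)$. It satisfies $A^\dagger Ax=(I_X-\pi_{\mathcal N(A)})x$ for $x\in X$. A sequence of homogeneous mappings $X_k\colon Y\to X$ is a (sequential) regularization if, as $k\to\infty$, $X_ky\to A^\dagger y$ for all $y\in\mathcal D(A^\dagger)$ and $AX_ky\to\pi_{\overline{\mathcal R(A)}}y$ for all $y\in Y$ (norm convergence). *)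

theory Defs
  imports "HOL-Analysis.Analysis"
begin

definition reflexive_space :: "'a::real_normed_vector itself \<Rightarrow> bool" where
  "reflexive_space TYPE('a) \<longleftrightarrow>
     (\<forall>\<phi> :: ('a \<Rightarrow>\<^sub>L real) \<Rightarrow>\<^sub>L real. \<exists>x :: 'a. \<forall>f. blinfun_apply \<phi> f = blinfun_apply f x)"

definition strictly_convex_space :: "'a::real_normed_vector itself \<Rightarrow> bool" where
  "strictly_convex_space TYPE('a) \<longleftrightarrow>
     (\<forall>x y :: 'a. norm x = 1 \<and> norm y = 1 \<and> x \<noteq> y \<longrightarrow> norm (x + y) < 2)"

(* infdist z U is the infimum of dist z u = norm (z - u) over u in U. The description is
   meaningful for closed subspaces of reflexive strictly convex Banach spaces. *)
definition metric_proj :: "'a::real_normed_vector set \<Rightarrow> 'a \<Rightarrow> 'a" where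
  "metric_proj U z = (THE u. u \<in> U \<and> norm (z - u) = infdist z U)"

definition duality_rel :: "('a::real_normed_vector \<times> ('a \<Rightarrow>\<^sub>L real)) set" where
  "duality_rel = {(x, f). blinfun_apply f x = (norm x)\<^sup>2 \<and> (norm x)\<^sup>2 = (norm f)\<^sup>2}"

definition duality_single_valued :: "'a::real_normed_vector itself \<Rightarrow> bool" where
  "duality_single_valued TYPE('a) \<longleftrightarrow>
     single_valued (duality_rel :: ('a \<times> ('a \<Rightarrow>\<^sub>L real)) set) \<and>
     single_valued ((duality_rel :: ('a \<times> ('a \<Rightarrow>\<^sub>L real)) set)\<inverse>)"

definition duality_map :: "'a::real_normed_vector \<Rightarrow> ('a \<Rightarrow>\<^sub>L real)" where
  "duality_map x = (THE f. (x, f) \<in> duality_rel)"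

definition annihilator :: "'a::real_normed_vector set \<Rightarrow> ('a \<Rightarrow>\<^sub>L real) set" where
  "annihilator U = {f. \<forall>u\<in>U. blinfun_apply f u = 0}"

definition dual_op :: "('a::real_normed_vector \<Rightarrow>\<^sub>L 'b::real_normed_vector)
    \<Rightarrow> ('b \<Rightarrow>\<^sub>L real) \<Rightarrow> ('a \<Rightarrow>\<^sub>L real)" where
  "dual_op A f = f o\<^sub>L A"

definition homogeneous :: "('a::real_vector \<Rightarrow> 'b::real_vector) \<Rightarrow> bool" where
  "homogeneous F \<longleftrightarrow> (\<forall>c x. F (c *\<^sub>R x) = c *\<^sub>R F x)"

definition null_space :: "('a::real_normed_vector \<Rightarrow>\<^sub>L 'b::real_normed_vector) \<Rightarrow> 'a set" where
  "null_space A = {x. blinfun_apply A x = 0}"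

definition proj_null :: "('a::real_normed_vector \<Rightarrow>\<^sub>L 'b::real_normed_vector) \<Rightarrow> 'a \<Rightarrow> 'a" where
  "proj_null A = metric_proj (null_space A)"

definition proj_range :: "('a::real_normed_vector \<Rightarrow>\<^sub>L 'b::real_normed_vector) \<Rightarrow> 'b \<Rightarrow> 'b" where
  "proj_range A = metric_proj (closure (range (blinfun_apply A)))"

definition smallness_condition ::
    "('a::real_normed_vector \<Rightarrow>\<^sub>L 'b::real_normed_vector) \<Rightarrow> ('b \<Rightarrow> 'a) \<Rightarrow> bool" where
  "smallness_condition A X0 \<longleftrightarrow>
     (\<forall>y. proj_null A (X0 y) = 0) \<and>
     (\<forall>y. X0 (proj_range A y) = X0 y) \<and>
     (\<exists>q::real. 0 < q \<and> q < 1 \<and>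
        (\<forall>x y. norm x \<le> 1 \<and> norm y \<le> 1 \<longrightarrow>
           norm (x - proj_null A x - X0 (blinfun_apply A x)) \<le> q \<and>
           norm (proj_range A y - blinfun_apply A (X0 y)) \<le> q))"

definition CX :: "('a::real_normed_vector \<Rightarrow>\<^sub>L 'b::real_normed_vector) \<Rightarrow> 'a set" where
  "CX A = {x. duality_map x \<in> annihilator (null_space A)}"

definition CY :: "('a::real_normed_vector \<Rightarrow>\<^sub>L 'b::real_normed_vector) \<Rightarrow> 'b set" where
  "CY A = {y. duality_map y \<in> annihilator (range (blinfun_apply A))}"

definition ginv_domain :: "('a::real_normed_vector \<Rightarrow>\<^sub>L 'b::real_normed_vector) \<Rightarrow> 'b set" where
  "ginv_domain A = {r + c | r c. r \<in> range (blinfun_apply A) \<and> c \<in> CY A}"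

(* Significant only for y in ginv_domain A, where the projection of y lies in the range of A. *)
definition metric_ginv ::
    "('a::real_normed_vector \<Rightarrow>\<^sub>L 'b::real_normed_vector) \<Rightarrow> 'b \<Rightarrow> 'a" where
  "metric_ginv A y = inv_into (CX A) (blinfun_apply A) (proj_range A y)"

definition sequential_regularization ::
    "('a::real_normed_vector \<Rightarrow>\<^sub>L 'b::real_normed_vector) \<Rightarrow> (nat \<Rightarrow> 'b \<Rightarrow> 'a) \<Rightarrow> bool" where
  "sequential_regularization A X \<longleftrightarrow>
     (\<forall>k. homogeneous (X k)) \<and>
     (\<forall>y\<in>ginv_domain A. (\<lambda>k. X k y) \<longlonglongrightarrow> metric_ginv A y) \<and>
     (\<forall>y. (\<lambda>k. blinfun_apply A (X k y)) \<longlonglongrightarrow> proj_range A y)"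

definition residual ::
    "('a::real_normed_vector \<Rightarrow>\<^sub>L 'b::real_normed_vector) \<Rightarrow> ('b \<Rightarrow> 'a) \<Rightarrow> 'b \<Rightarrow> 'b" where
  "residual A F y = proj_range A y - blinfun_apply A (F y)"

primrec schulz_newton ::
    "('a::real_normed_vector \<Rightarrow>\<^sub>L 'b::real_normed_vector) \<Rightarrow> ('b \<Rightarrow> 'a) \<Rightarrow> nat \<Rightarrow> 'b \<Rightarrow> 'a" where
  "schulz_newton A X0 0 = X0"
| "schulz_newton A X0 (Suc k) =
     (\<lambda>y. schulz_newton A X0 k y
        + schulz_newton A X0 k (residual A (schulz_newton A X0 k) y))"

definition landweber_B ::
    "('a::real_normed_vector \<Rightarrow>\<^sub>L 'b::real_normed_vector) \<Rightarrow> 'b \<Rightarrow> 'a" where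
  "landweber_B A y = inv duality_map (dual_op A (duality_map y))"

primrec landweber ::
    "('a::real_normed_vector \<Rightarrow>\<^sub>L 'b::real_normed_vector) \<Rightarrow> real \<Rightarrow> ('b \<Rightarrow> 'a) \<Rightarrow> nat \<Rightarrow> 'b \<Rightarrow> 'a" where
  "landweber A \<mu> X0 0 = X0"
| "landweber A \<mu> X0 (Suc k) =
     (\<lambda>y. landweber A \<mu> X0 k y
        + \<mu> *\<^sub>R landweber_B A (residual A (landweber A \<mu> X0 k) y))"

end

theory Submission imports Defs begin

text \<open>Write \<open>P = proj_null A\<close> and \<open>Q = proj_range A\<close>, and attach to a mapping \<open>F\<close> from the target
  space to the domain the two errors \<open>R F = Q - A F\<close> and \<open>T F = I - P - F A\<close>. Both iterations
  have the form \<open>H = F + G (R F)\<close>: Schulz-Newton with \<open>G = F\<close>, Landweber with \<open>G = X0\<close>. The errors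
  of \<open>H\<close> are compositions, \<open>R H = R G \<circ> R F\<close> and \<open>T H = T G \<circ> T F\<close>. The first identity holds
  because the values of \<open>R F\<close> lie in the closure of the range, where \<open>Q\<close> is the identity; the second holds
  because the linearity of \<open>P\<close> puts the values of \<open>T F\<close> in the kernel of \<open>P\<close>, provided that \<open>F\<close>
  itself takes values there. The smallness condition and homogeneity bound both errors of \<open>X0\<close> at a
  point by \<open>q\<close> times its norm. Hence the errors of the \<open>k\<close>-th iterate are at most
  \<open>q ^ 2 ^ k\<close> and \<open>q ^ (k + 1)\<close> times the norm, respectively, by
  \<open>approximate_inverse_corrected\<close>.

  Vanishing \<open>R\<close> is convergence of \<open>A (X k y)\<close> to \<open>Q y\<close>. If \<open>y\<close> is in the domain of the generalized
  inverse and \<open>x\<close> is its image, then \<open>A x = Q y\<close>, \<open>P x = 0\<close> and \<open>X k y = X k (Q y)\<close>, so that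
  \<open>X k y = x - T (X k) x\<close> tends to \<open>x\<close>.

  The functional-analytic input is that \<open>P\<close> and \<open>Q\<close> are well defined and that such an \<open>x\<close> exists.
  Both follow from the Hahn-Banach theorem: reflexivity turns norm-preserving extensions of functionals
  on annihilators into best approximations (\<open>best_approximation_exists\<close>), and a functional
  attaining the distance to a subspace shows that the kernel of a metric projection is the set of
  points whose image under the duality map annihilates the subspace
  (\<open>duality_map_annihilates_iff\<close>). The latter yields \<open>P x = 0\<close> on \<open>CX A\<close> and \<open>Q c = 0\<close> on
  \<open>CY A\<close>, together with the converses.\<close>

section \<open>The Hahn-Banach theorem\<close>

text \<open>The value \<open>a\<close> at the new point \<open>z\<close> has to lie above all \<open>b - p (x - z)\<close> and below all
  \<open>p (x + z) - b\<close> with \<open>(x, b)\<close> in the graph; subadditivity makes the former lie below the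
  latter, so their supremum serves.\<close>

lemma dominated_graph_extension:
  fixes G :: "('a::real_vector \<times> real) set" and p :: "'a \<Rightarrow> real"
  assumes G: "subspace G" and dom: "\<And>x a. (x, a) \<in> G \<Longrightarrow> a \<le> p x"
    and add: "\<And>x y. p (x + y) \<le> p x + p y"
    and scale: "\<And>c x. c > 0 \<Longrightarrow> p (c *\<^sub>R x) = c * p x"
  shows "\<exists>a H. subspace H \<and> G \<subseteq> H \<and> (z, a) \<in> H \<and> (\<forall>x b. (x, b) \<in> H \<longrightarrow> b \<le> p x)"
proof -
  let ?S = "(\<lambda>(x, b). b - p (x - z)) ` G"
  define a where "a = Sup ?S"
  have zero: "(0, 0) \<in> G"
    using subspace_0[OF G] by (simp add: zero_prod_def)
  have sep: "b' - p (x' - z) \<le> p (x + z) - b" if "(x, b) \<in> G" "(x', b') \<in> G" for x b x' b'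
  proof -
    have "(x + x', b + b') \<in> G"
      using subspace_add[OF G that] by simp
    then have "b + b' \<le> p (x + x')"
      by (rule dom)
    also have "\<dots> \<le> p (x + z) + p (x' - z)"
      using add[of "x + z" "x' - z"] by (simp add: algebra_simps)
    finally show ?thesis by simp
  qed
  have bdd: "bdd_above ?S"
    using sep[OF zero] by (intro bdd_aboveI[where M = "p (0 + z) - 0"]) auto
  have lower: "b - p (x - z) \<le> a" if "(x, b) \<in> G" for x b
    unfolding a_def using that by (intro cSup_upper[OF _ bdd]) force
  have upper: "a \<le> p (x + z) - b" if "(x, b) \<in> G" for x b
    unfolding a_def using zero sep[OF that] by (intro cSup_least) auto
  have bound: "b + t * a \<le> p (x + t *\<^sub>R z)" if xb: "(x, b) \<in> G" for x b t
  proof -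
    consider "t = 0" | "t > 0" | "t < 0" by linarith
    then show ?thesis
    proof cases
      case 1
      then show ?thesis using dom[OF xb] by simp
    next
      case 2
      have "(x /\<^sub>R t, b / t) \<in> G"
        using subspace_scale[OF G xb, of "inverse t"] by (simp add: divide_inverse_commute)
      from mult_left_mono[OF upper[OF this], of t] 2
      have "t * a \<le> t * p (x /\<^sub>R t + z) - b"
        by (simp add: algebra_simps)
      also have "t * p (x /\<^sub>R t + z) = p (x + t *\<^sub>R z)"
        using scale[OF 2, of "x /\<^sub>R t + z"] 2 by (simp add: scaleR_add_right)
      finally show ?thesis by simp
    next
      case 3
      define s where "s = - t"
      have s: "s > 0" using 3 by (simp add: s_def)
      have "(x /\<^sub>R s, b / s) \<in> G"
        using subspace_scale[OF G xb, of "inverse s"] by (simp add: divide_inverse_commute)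
      from mult_left_mono[OF lower[OF this], of s] s
      have "b - s * p (x /\<^sub>R s - z) \<le> s * a"
        by (simp add: algebra_simps)
      moreover have "s * p (x /\<^sub>R s - z) = p (x - s *\<^sub>R z)"
        using scale[OF s, of "x /\<^sub>R s - z"] s by (simp add: scaleR_diff_right)
      ultimately show ?thesis by (simp add: s_def)
    qed
  qed
  \<comment> \<open>Elements of the span have the form \<open>g + t *\<^sub>R (z, a)\<close> with \<open>g\<close> in \<open>G\<close>, which is what
    \<open>bound\<close> treats.\<close>
  define H where "H = span (insert (z, a) G)"
  have "b \<le> p x" if "(x, b) \<in> H" for x b
  proof -
    obtain t where "(x, b) - t *\<^sub>R (z, a) \<in> G"
      using \<open>(x, b) \<in> H\<close> G by (auto simp: H_def span_breakdown_eq span_eq_iff[THEN iffD2])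
    from bound[of "x - t *\<^sub>R z" "b - t * a" t] this show ?thesis by simp
  qed
  moreover have "subspace H" "G \<subseteq> H" "(z, a) \<in> H"
    by (auto simp: H_def span_base)
  ultimately show ?thesis by blast
qed

text \<open>Partial functionals are represented by their graphs, which are subspaces of the product
  with \<open>\<real>\<close>. A dominated subspace is automatically the graph of a function: from
  \<open>(0, a) \<in> M\<close> it follows that all multiples of \<open>a\<close> are at most \<open>p 0 = 0\<close>. Hence Zorn's lemma
  can be applied to sets ordered by inclusion.\<close>

theorem hahn_banach_graph:
  fixes G :: "('a::real_vector \<times> real) set" and p :: "'a \<Rightarrow> real"
  assumes G: "subspace G" and dom: "\<And>x a. (x, a) \<in> G \<Longrightarrow> a \<le> p x"
    and add: "\<And>x y. p (x + y) \<le> p x + p y"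
    and scale: "\<And>c x. c > 0 \<Longrightarrow> p (c *\<^sub>R x) = c * p x"
  obtains f where "linear f" "\<And>x. f x \<le> p x" "\<And>x a. (x, a) \<in> G \<Longrightarrow> f x = a"
proof -
  define \<A> where "\<A> = {H. subspace H \<and> G \<subseteq> H \<and> (\<forall>x a. (x, a) \<in> H \<longrightarrow> a \<le> p x)}"
  have "\<exists>M\<in>\<A>. \<forall>H\<in>\<A>. M \<subseteq> H \<longrightarrow> H = M"
  proof (rule subset_Zorn_nonempty)
    show "\<A> \<noteq> {}"
      using G dom by (auto simp: \<A>_def)
  next
    fix \<C> assume ne: "\<C> \<noteq> {}" and chain: "subset.chain \<A> \<C>"
    have C: "H \<in> \<A>" if "H \<in> \<C>" for H
      using chain that by (auto simp: subset.chain_def)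
    have "subspace (\<Union>\<C>)"
    proof (rule subspaceI)
      show "0 \<in> \<Union>\<C>"
        using ne C subspace_0 by (fastforce simp: \<A>_def)
    next
      fix v w assume "v \<in> \<Union>\<C>" "w \<in> \<Union>\<C>"
      then obtain H K where HK: "H \<in> \<C>" "K \<in> \<C>" "v \<in> H" "w \<in> K" by blast
      then have "H \<subseteq> K \<or> K \<subseteq> H"
        using chain by (auto simp: subset.chain_def)
      then obtain L where "L \<in> \<C>" "v \<in> L" "w \<in> L"
        using HK by blast
      then show "v + w \<in> \<Union>\<C>"
        using C by (auto simp: \<A>_def intro: subspace_add)
    next
      fix c v assume "v \<in> \<Union>\<C>"
      then show "c *\<^sub>R v \<in> \<Union>\<C>"
        using C by (auto simp: \<A>_def intro: subspace_scale)
    qed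
    then show "\<Union>\<C> \<in> \<A>"
      using ne C by (auto simp: \<A>_def)
  qed
  then obtain M where M: "M \<in> \<A>" and max: "\<And>H. H \<in> \<A> \<Longrightarrow> M \<subseteq> H \<Longrightarrow> H = M"
    by blast
  have sub: "subspace M" and GM: "G \<subseteq> M" and domM: "\<And>x a. (x, a) \<in> M \<Longrightarrow> a \<le> p x"
    using M by (auto simp: \<A>_def)
  have total: "\<exists>a. (z, a) \<in> M" for z
  proof -
    obtain a H where H: "subspace H" "M \<subseteq> H" "(z, a) \<in> H" "\<forall>x b. (x, b) \<in> H \<longrightarrow> b \<le> p x"
      using dominated_graph_extension[OF sub domM add scale, of z] by blast
    then have "H = M"
      using GM by (intro max) (auto simp: \<A>_def)
    then show ?thesis using H by blast
  qed
  have p0: "p 0 = 0"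
    using scale[of 2 0] by simp
  have unique: "a = b" if "(x, a) \<in> M" "(x, b) \<in> M" for x a b
  proof -
    have "(0, a - b) \<in> M" "(0, b - a) \<in> M"
      using subspace_diff[OF sub that] subspace_diff[OF sub that(2,1)] by simp_all
    then have "a - b \<le> p 0" "b - a \<le> p 0"
      by (auto intro: domM)
    then show ?thesis using p0 by simp
  qed
  define f where "f x = (THE a. (x, a) \<in> M)" for x
  have f_eq: "f x = a" if "(x, a) \<in> M" for x a
    unfolding f_def using that unique by blast
  have f_in: "(x, f x) \<in> M" for x
    using total[of x] f_eq by blast
  have "linear f"
    using subspace_add[OF sub f_in f_in] subspace_scale[OF sub f_in]
    by (intro linearI) (auto intro!: f_eq)
  then show thesis
    using that[of f] domM f_in f_eq GM by blast
qed

section \<open>Functionals measuring the distance to a subspace\<close>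

lemma infdist_greatest:
  assumes "U \<noteq> {}" "\<And>u. u \<in> U \<Longrightarrow> c \<le> dist z u"
  shows "c \<le> infdist z U"
  using assms by (auto simp: infdist_notempty intro: cINF_greatest)

lemma infdist_subspace_scale:
  fixes U :: "'a::real_normed_vector set"
  assumes U: "subspace U" and c: "c > 0"
  shows "infdist (c *\<^sub>R z) U = c * infdist z U"
proof -
  have U0: "U \<noteq> {}" using subspace_0[OF U] by blast
  have le: "infdist (d *\<^sub>R w) U \<le> d * infdist w U" if d: "d > 0" for d w
  proof -
    have "infdist (d *\<^sub>R w) U / d \<le> infdist w U"
    proof (rule infdist_greatest[OF U0])
      fix u assume "u \<in> U"
      then have "infdist (d *\<^sub>R w) U \<le> dist (d *\<^sub>R w) (d *\<^sub>R u)"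
        by (intro infdist_le subspace_scale[OF U])
      also have "\<dots> = d * dist w u"
        using d by (simp add: dist_norm flip: scaleR_diff_right)
      finally show "infdist (d *\<^sub>R w) U / d \<le> dist w u"
        using d by (simp add: field_simps)
    qed
    then show ?thesis using d by (simp add: field_simps)
  qed
  from le[of "inverse c" "c *\<^sub>R z"] le[of c z] c show ?thesis
    by (simp add: field_simps)
qed

lemma infdist_subspace_add:
  fixes U :: "'a::real_normed_vector set"
  assumes U: "subspace U"
  shows "infdist (z + w) U \<le> infdist z U + infdist w U"
proof -
  have U0: "U \<noteq> {}" using subspace_0[OF U] by blast
  have "infdist (z + w) U - infdist w U \<le> dist z u" if u: "u \<in> U" for u
  proof -
    have "infdist (z + w) U - dist z u \<le> infdist w U"
    proof (rule infdist_greatest[OF U0])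
      fix v assume "v \<in> U"
      then have "infdist (z + w) U \<le> dist (z + w) (u + v)"
        using u by (intro infdist_le subspace_add[OF U])
      also have "\<dots> \<le> dist z u + dist w v"
        by (rule dist_triangle_add)
      finally show "infdist (z + w) U - dist z u \<le> dist w v" by simp
    qed
    then show ?thesis by simp
  qed
  from infdist_greatest[OF U0 this] show ?thesis by simp
qed

lemma infdist_subspace_le_norm: "subspace U \<Longrightarrow> infdist z U \<le> norm z"
  using infdist_le[of 0 U z] subspace_0 by fastforce

lemma bounded_functional:
  fixes f :: "'a::real_normed_vector \<Rightarrow> real"
  assumes "linear f" "\<And>x. f x \<le> C * norm x"
  obtains g where "blinfun_apply g = f" "\<And>x. \<bar>f x\<bar> \<le> C * norm x"
proof -
  have abs: "\<bar>f x\<bar> \<le> C * norm x" for x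
    using assms(2)[of x] assms(2)[of "- x"] linear_neg[OF assms(1), of x] by simp
  have "bounded_linear f"
    using assms(1) abs
    by (auto simp: bounded_linear_def bounded_linear_axioms_def mult.commute)
  then show thesis
    using that[of "Blinfun f"] abs by (simp add: bounded_linear_Blinfun_apply)
qed

text \<open>Dominating by the seminorm \<open>\<lambda>z. infdist z U\<close> gives both properties of the functional at
  once: this seminorm vanishes on \<open>U\<close> and is at most the norm.\<close>

lemma functional_attaining_infdist:
  fixes U :: "'a::real_normed_vector set"
  assumes U: "subspace U"
  obtains f where "f \<in> annihilator U" "blinfun_apply f z = infdist z U" "norm f \<le> 1"
proof -
  let ?p = "\<lambda>x. infdist x U"
  have dom: "a \<le> ?p x" if "(x, a) \<in> range (\<lambda>t. t *\<^sub>R (z, ?p z))" for x a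
  proof -
    obtain t where t: "x = t *\<^sub>R z" "a = t * ?p z"
      using \<open>(x, a) \<in> _\<close> by auto
    show ?thesis
    proof (cases "t > 0")
      case True
      then show ?thesis using t infdist_subspace_scale[OF U] by simp
    next
      case False
      then have "a \<le> 0"
        using t infdist_nonneg[of z U] by (simp add: mult_nonpos_nonneg)
      then show ?thesis using infdist_nonneg[of x U] by linarith
    qed
  qed
  have "subspace (range (\<lambda>t. t *\<^sub>R (z, ?p z)))"
    using subspace_span[of "{(z, ?p z)}"] by (simp add: span_singleton)
  from hahn_banach_graph[OF this dom infdist_subspace_add[OF U] infdist_subspace_scale[OF U]]
  obtain f where f: "linear f" "\<And>x. f x \<le> ?p x"
    and fG: "\<And>x a. (x, a) \<in> range (\<lambda>t. t *\<^sub>R (z, ?p z)) \<Longrightarrow> f x = a"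
    by blast
  have fz: "f z = ?p z"
    by (rule fG) (auto intro!: image_eqI[where x = 1])
  have "f x \<le> 1 * norm x" for x
    using f(2)[of x] infdist_subspace_le_norm[OF U, of x] by simp
  from bounded_functional[OF f(1) this]
  obtain g where g: "blinfun_apply g = f" "\<And>x. \<bar>f x\<bar> \<le> 1 * norm x"
    by blast
  have "f u = 0" if u: "u \<in> U" for u
  proof -
    have "f u \<le> 0" "f (- u) \<le> 0"
      using f(2)[of u] f(2)[of "- u"] u subspace_neg[OF U u] by simp_all
    then show ?thesis using linear_neg[OF f(1), of u] by simp
  qed
  moreover have "norm g \<le> 1"
    using g by (intro norm_blinfun_bound) auto
  ultimately show thesis
    using that[of g] fz g(1) by (simp add: annihilator_def)
qed

section \<open>Best approximation and the duality map\<close>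

text \<open>On \<open>annihilator U\<close> evaluation at \<open>z\<close> has norm at most \<open>infdist z U\<close>. By reflexivity a
  norm-preserving extension of it is evaluation at some point \<open>x\<close> with
  \<open>norm x \<le> infdist z U\<close>; since \<open>z - x\<close> is annihilated by \<open>annihilator U\<close>, it lies in \<open>U\<close>.\<close>

lemma best_approximation_exists:
  fixes U :: "'a::real_normed_vector set"
  assumes R: "reflexive_space TYPE('a)" and U: "subspace U" "closed U"
  shows "\<exists>u\<in>U. norm (z - u) = infdist z U"
proof -
  let ?d = "infdist z U"
  define G where "G = (\<lambda>f. (f, blinfun_apply f z)) ` annihilator U"
  have U0: "U \<noteq> {}" using subspace_0[OF U(1)] by blast
  have G: "subspace G"
    by (rule subspaceI)
       (auto simp: G_def annihilator_def zero_prod_def blinfun.add_left blinfun.scaleR_left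
             intro!: image_eqI)
  have dom: "a \<le> ?d * norm f" if "(f, a) \<in> G" for f a
  proof (cases "f = 0")
    case True
    then show ?thesis using that by (auto simp: G_def)
  next
    case False
    have "a / norm f \<le> ?d"
    proof (rule infdist_greatest[OF U0])
      fix u assume "u \<in> U"
      then have "a = blinfun_apply f (z - u)"
        using that by (auto simp: G_def annihilator_def blinfun.diff_right)
      then have "a \<le> norm f * norm (z - u)"
        using norm_blinfun[of f "z - u"] by simp
      then show "a / norm f \<le> dist z u"
        using False by (simp add: dist_norm field_simps)
    qed
    then show ?thesis using False by (simp add: field_simps)
  qed
  have sub: "?d * norm (f + g) \<le> ?d * norm f + ?d * norm g" for f g :: "'a \<Rightarrow>\<^sub>L real"
    using mult_left_mono[OF norm_triangle_ineq[of f g] infdist_nonneg[of z U]]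
    by (simp add: algebra_simps)
  obtain \<phi> where \<phi>: "linear \<phi>" "\<And>f. \<phi> f \<le> ?d * norm f" "\<And>f a. (f, a) \<in> G \<Longrightarrow> \<phi> f = a"
    by (rule hahn_banach_graph[where p = "\<lambda>f. ?d * norm f", OF G dom sub]) auto
  obtain \<Phi> where \<Phi>: "blinfun_apply \<Phi> = \<phi>"
    using bounded_functional[OF \<phi>(1,2)] by blast
  obtain x where x: "\<And>f. \<phi> f = blinfun_apply f x"
    using R \<Phi> unfolding reflexive_space_def by metis
  have "z - x \<in> U"
  proof -
    obtain f where f: "f \<in> annihilator U" "blinfun_apply f (z - x) = infdist (z - x) U"
      using functional_attaining_infdist[OF U(1)] by metis
    have "blinfun_apply f x = blinfun_apply f z"
      using \<phi>(3)[of f] f(1) x[of f] by (simp add: G_def)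
    then have "infdist (z - x) U = 0"
      using f(2) by (simp add: blinfun.diff_right)
    then show ?thesis
      using in_closed_iff_infdist_zero[OF U(2) U0] by blast
  qed
  moreover have "norm (z - (z - x)) = ?d"
  proof (rule antisym)
    obtain f where f: "blinfun_apply f x = infdist x {0}" "norm f \<le> 1"
      using functional_attaining_infdist[OF subspace_single_0] by metis
    have "norm x = blinfun_apply f x"
      using f(1) by simp
    also have "\<dots> \<le> ?d * norm f"
      using \<phi>(2)[of f] x by simp
    also have "\<dots> \<le> ?d"
      using mult_left_mono[OF f(2) infdist_nonneg[of z U]] by simp
    finally show "norm (z - (z - x)) \<le> ?d" by simp
  next
    show "?d \<le> norm (z - (z - x))"
      using infdist_le[OF \<open>z - x \<in> U\<close>, of z] by (simp add: dist_norm)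
  qed
  ultimately show ?thesis by blast
qed

lemma best_approximation_unique:
  fixes U :: "'a::real_normed_vector set"
  assumes S: "strictly_convex_space TYPE('a)" and U: "subspace U"
    and u: "u \<in> U" "norm (z - u) = infdist z U"
    and v: "v \<in> U" "norm (z - v) = infdist z U"
  shows "u = v"
proof (rule ccontr)
  assume "u \<noteq> v"
  define d where "d = infdist z U"
  have "d \<noteq> 0"
    using u v \<open>u \<noteq> v\<close> by (auto simp: d_def)
  then have d: "d > 0"
    using infdist_nonneg[of z U] by (simp add: d_def)
  define m where "m = z - (1/2) *\<^sub>R (u + v)"
  let ?a = "(z - u) /\<^sub>R d" and ?b = "(z - v) /\<^sub>R d"
  have "norm ?a = 1" "norm ?b = 1" "?a \<noteq> ?b"
    using u v d \<open>u \<noteq> v\<close> by (auto simp: d_def)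
  then have "norm (?a + ?b) < 2"
    using S by (auto simp: strictly_convex_space_def)
  moreover have "?a + ?b = (2 / d) *\<^sub>R m"
  proof -
    have "?a + ?b = ((z - u) + (z - v)) /\<^sub>R d"
      by (rule scaleR_add_right[symmetric])
    also have "(z - u) + (z - v) = 2 *\<^sub>R m"
      by (simp add: m_def scaleR_diff_right scaleR_2)
    also have "(2 *\<^sub>R m) /\<^sub>R d = (2 / d) *\<^sub>R m"
      by (simp add: divide_inverse mult.commute)
    finally show ?thesis .
  qed
  ultimately have "norm ((2 / d) *\<^sub>R m) < 2"
    by simp
  then have "norm m < d"
    using d by (simp add: field_simps)
  moreover have "d \<le> norm m"
    unfolding d_def m_def dist_norm[symmetric] using u v U
    by (intro infdist_le subspace_scale subspace_add)
  ultimately show False by simp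
qed

locale chebyshev_subspace =
  fixes U :: "'a::real_normed_vector set"
  assumes reflexive: "reflexive_space TYPE('a)" and strict: "strictly_convex_space TYPE('a)"
    and subspace: "subspace U" and closed: "closed U"
begin

lemma metric_proj:
  shows metric_proj_in: "metric_proj U z \<in> U"
    and norm_metric_proj: "norm (z - metric_proj U z) = infdist z U"
proof -
  have "\<exists>!u. u \<in> U \<and> norm (z - u) = infdist z U"
    using best_approximation_exists[OF reflexive subspace closed, of z]
      best_approximation_unique[OF strict subspace] by blast
  from theI'[OF this]
  show "metric_proj U z \<in> U" "norm (z - metric_proj U z) = infdist z U"
    by (auto simp: metric_proj_def)
qed

lemma metric_proj_eqI:
  assumes "u \<in> U" "\<And>v. v \<in> U \<Longrightarrow> norm (z - u) \<le> norm (z - v)"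
  shows "metric_proj U z = u"
proof (rule best_approximation_unique[OF strict subspace metric_proj_in norm_metric_proj assms(1)])
  show "norm (z - u) = infdist z U"
    using assms infdist_le[OF assms(1), of z]
    by (intro antisym infdist_greatest) (auto simp: dist_norm)
qed

lemma metric_proj_le: "v \<in> U \<Longrightarrow> norm (z - metric_proj U z) \<le> norm (z - v)"
  using infdist_le[of v U z] by (simp add: norm_metric_proj dist_norm)

lemma metric_proj_of_mem: "u \<in> U \<Longrightarrow> metric_proj U u = u"
  by (rule metric_proj_eqI) auto

lemma metric_proj_add: "r \<in> U \<Longrightarrow> metric_proj U (r + z) = r + metric_proj U z"
proof (rule metric_proj_eqI)
  fix v assume "r \<in> U" "v \<in> U"
  then show "norm (r + z - (r + metric_proj U z)) \<le> norm (r + z - v)"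
    using metric_proj_le[of "v - r" z] subspace_diff[OF subspace]
    by (simp add: algebra_simps)
qed (intro subspace_add[OF subspace] metric_proj_in)

lemma homogeneous_metric_proj: "homogeneous (metric_proj U)"
  unfolding homogeneous_def
proof (intro allI)
  fix c z
  show "metric_proj U (c *\<^sub>R z) = c *\<^sub>R metric_proj U z"
  proof (cases "c = 0")
    case True
    then show ?thesis
      by (simp add: metric_proj_of_mem subspace_0[OF subspace])
  next
    case False
    show ?thesis
    proof (rule metric_proj_eqI)
      fix v assume "v \<in> U"
      then have "norm (z - metric_proj U z) \<le> norm (z - v /\<^sub>R c)"
        by (intro metric_proj_le subspace_scale[OF subspace])
      then have "\<bar>c\<bar> * norm (z - metric_proj U z) \<le> \<bar>c\<bar> * norm (z - v /\<^sub>R c)"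
        by (simp add: mult_left_mono)
      then show "norm (c *\<^sub>R z - c *\<^sub>R metric_proj U z) \<le> norm (c *\<^sub>R z - v)"
        using False by (simp flip: norm_scaleR add: scaleR_diff_right)
    qed (intro subspace_scale[OF subspace] metric_proj_in)
  qed
qed

text \<open>If \<open>0\<close> is the best approximation of \<open>z\<close>, then the distance functional attains \<open>norm z\<close>
  at \<open>z\<close>; scaling it by \<open>norm z\<close> gives a dual element.\<close>

lemma duality_rel_of_metric_proj_eq_0:
  assumes "metric_proj U z = 0"
  obtains f where "(z, f) \<in> duality_rel" "f \<in> annihilator U"
proof -
  have inf: "infdist z U = norm z"
    using norm_metric_proj[of z] assms by simp
  obtain f where f: "f \<in> annihilator U" "blinfun_apply f z = norm z" "norm f \<le> 1"
    using functional_attaining_infdist[OF subspace, of z] inf by metis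
  let ?g = "norm z *\<^sub>R f"
  have "norm z * 1 \<le> norm z * norm f"
    using norm_blinfun[of f z] f(2) by (simp add: mult.commute)
  moreover have "norm z * norm f \<le> norm z * 1"
    using mult_left_mono[OF f(3), of "norm z"] by simp
  ultimately have "norm ?g = norm z"
    by simp
  then have "(norm ?g)\<^sup>2 = (norm z)\<^sup>2"
    by (rule arg_cong)
  then have "(z, ?g) \<in> duality_rel"
    unfolding duality_rel_def by (simp only: mem_Collect_eq prod.case)
      (simp add: f(2) blinfun.scaleR_left power2_eq_square)
  moreover have "?g \<in> annihilator U"
    using f(1) by (simp add: annihilator_def blinfun.scaleR_left)
  ultimately show thesis by (rule that)
qed

lemma metric_proj_eq_0_if_duality_rel:
  assumes "(z, f) \<in> duality_rel" "f \<in> annihilator U"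
  shows "metric_proj U z = 0"
proof (rule metric_proj_eqI)
  fix v assume "v \<in> U"
  have f: "blinfun_apply f z = (norm z)\<^sup>2" "norm f = norm z"
    using assms(1) by (auto simp: duality_rel_def)
  have "norm z * norm z = blinfun_apply f (z - v)"
    using f(1) assms(2) \<open>v \<in> U\<close> by (simp add: annihilator_def blinfun.diff_right power2_eq_square)
  also have "\<dots> \<le> norm z * norm (z - v)"
    using norm_blinfun[of f "z - v"] f(2) by simp
  finally show "norm (z - 0) \<le> norm (z - v)"
    by (cases "z = 0") auto
qed (rule subspace_0[OF subspace])

end

lemma duality_map_eq:
  fixes x :: "'a::real_normed_vector"
  assumes "duality_single_valued TYPE('a)" "(x, f) \<in> duality_rel"
  shows "duality_map x = f"
  unfolding duality_map_def using assms
  by (auto simp: duality_single_valued_def dest: single_valuedD)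

lemma duality_map_in_duality_rel:
  fixes x :: "'a::real_normed_vector"
  assumes "reflexive_space TYPE('a)" "strictly_convex_space TYPE('a)"
    and D: "duality_single_valued TYPE('a)"
  shows "(x, duality_map x) \<in> duality_rel"
proof -
  interpret chebyshev_subspace "{0 :: 'a}"
    using assms by unfold_locales auto
  have "metric_proj {0} x = 0"
    using metric_proj_in by simp
  from duality_rel_of_metric_proj_eq_0[OF this] show ?thesis
    using duality_map_eq[OF D] by metis
qed

text \<open>The kernel of a metric projection consists of the points whose dual image annihilates the
  subspace. This identifies \<open>CX A\<close> and \<open>CY A\<close> with the kernels of \<open>proj_null A\<close> and
  \<open>proj_range A\<close>.\<close>

lemma (in chebyshev_subspace) duality_map_annihilates_iff:
  assumes D: "duality_single_valued TYPE('a)"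
  shows "duality_map z \<in> annihilator U \<longleftrightarrow> metric_proj U z = 0"
proof
  assume "duality_map z \<in> annihilator U"
  then show "metric_proj U z = 0"
    using duality_map_in_duality_rel[OF reflexive strict D]
    by (rule metric_proj_eq_0_if_duality_rel[rotated])
next
  assume "metric_proj U z = 0"
  from duality_rel_of_metric_proj_eq_0[OF this] show "duality_map z \<in> annihilator U"
    using duality_map_eq[OF D] by metis
qed

lemma annihilator_closure: "annihilator (closure U) = annihilator U"
proof
  show "annihilator U \<subseteq> annihilator (closure U)"
  proof
    fix f assume "f \<in> annihilator U"
    then have "U \<subseteq> {u. blinfun_apply f u = 0}"
      by (auto simp: annihilator_def)
    moreover have "closed {u. blinfun_apply f u = 0}"
      by (intro closed_Collect_eq continuous_intros)
    ultimately have "closure U \<subseteq> {u. blinfun_apply f u = 0}"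
      by (rule closure_minimal)
    then show "f \<in> annihilator (closure U)"
      by (auto simp: annihilator_def)
  qed
qed (use closure_subset[of U] in \<open>auto simp: annihilator_def\<close>)

lemma subspace_closure:
  fixes U :: "'a::real_normed_vector set"
  assumes U: "subspace U"
  shows "subspace (closure U)"
proof (rule subspaceI)
  show "0 \<in> closure U"
    using subspace_0[OF U] closure_subset by blast
next
  fix v w assume "v \<in> closure U" "w \<in> closure U"
  then obtain f g where "\<forall>n. f n \<in> U" "f \<longlonglongrightarrow> v" "\<forall>n. g n \<in> U" "g \<longlonglongrightarrow> w"
    by (auto simp: closure_sequential)
  then show "v + w \<in> closure U"
    unfolding closure_sequential
    by (intro exI[of _ "\<lambda>n. f n + g n"]) (auto intro: tendsto_add subspace_add[OF U])
next
  fix c v assume "v \<in> closure U"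
  then obtain f where "\<forall>n. f n \<in> U" "f \<longlonglongrightarrow> v"
    by (auto simp: closure_sequential)
  then show "c *\<^sub>R v \<in> closure U"
    unfolding closure_sequential
    by (intro exI[of _ "\<lambda>n. c *\<^sub>R f n"]) (auto intro!: tendsto_scaleR subspace_scale[OF U])
qed

section \<open>Approximate generalized inverses\<close>

lemma homogeneous_norm_bound:
  fixes F :: "'a::real_normed_vector \<Rightarrow> 'b::real_normed_vector"
  assumes "homogeneous F" "\<And>x. norm x \<le> 1 \<Longrightarrow> norm (F x) \<le> q"
  shows "norm (F x) \<le> q * norm x"
proof -
  have scale: "F (c *\<^sub>R x) = c *\<^sub>R F x" for c
    using assms(1) by (simp add: homogeneous_def)
  show ?thesis
  proof (cases "x = 0")
    case True
    then show ?thesis using scale[of 0] by simp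
  next
    case False
    have "F x = norm x *\<^sub>R F (x /\<^sub>R norm x)"
      using False by (simp add: scale)
    then have "norm (F x) = norm x * norm (F (x /\<^sub>R norm x))"
      by (metis norm_scaleR abs_norm_cancel)
    also have "\<dots> \<le> norm x * q"
      using False by (intro mult_left_mono assms(2)) auto
    finally show ?thesis by (simp add: mult.commute)
  qed
qed

text \<open>The counterpart of \<open>residual\<close> on the domain side: the defect in \<open>F A = I - P\<close>, the
  identity which the generalized inverse satisfies in place of \<open>F\<close>.\<close>

definition left_residual ::
    "('a::real_normed_vector \<Rightarrow>\<^sub>L 'b::real_normed_vector) \<Rightarrow> ('b \<Rightarrow> 'a) \<Rightarrow> 'a \<Rightarrow> 'a" where
  "left_residual A F x = x - proj_null A x - F (blinfun_apply A x)"

text \<open>The properties of the initial mapping that correction steps preserve, with \<open>q\<close> the only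
  quantity that changes.\<close>

definition approximate_inverse ::
    "('a::real_normed_vector \<Rightarrow>\<^sub>L 'b::real_normed_vector) \<Rightarrow> real \<Rightarrow> ('b \<Rightarrow> 'a) \<Rightarrow> bool" where
  "approximate_inverse A q F \<longleftrightarrow>
     homogeneous F \<and> (\<forall>y. proj_null A (F y) = 0) \<and> (\<forall>y. F (proj_range A y) = F y) \<and>
     (\<forall>x. norm (left_residual A F x) \<le> q * norm x) \<and>
     (\<forall>y. norm (residual A F y) \<le> q * norm y)"

text \<open>One correction step: \<open>F\<close> is the current approximation and \<open>G\<close> the approximate inverse
  applied to its residual.\<close>

definition corrected ::
    "('a::real_normed_vector \<Rightarrow>\<^sub>L 'b::real_normed_vector) \<Rightarrow> ('b \<Rightarrow> 'a) \<Rightarrow> ('b \<Rightarrow> 'a) \<Rightarrow> 'b \<Rightarrow> 'a"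
  where "corrected A G F y = F y + G (residual A F y)"

locale generalized_inverse_setting =
  fixes A :: "'a::real_normed_vector \<Rightarrow>\<^sub>L 'b::real_normed_vector"
  assumes reflexive_X: "reflexive_space TYPE('a)" and strict_X: "strictly_convex_space TYPE('a)"
    and reflexive_Y: "reflexive_space TYPE('b)" and strict_Y: "strictly_convex_space TYPE('b)"
    and duality_X: "duality_single_valued TYPE('a)"
    and duality_Y: "duality_single_valued TYPE('b)"
    and linear_proj_null: "linear (proj_null A)"
begin

lemma closed_null_space: "closed (null_space A)"
  unfolding null_space_def by (intro closed_Collect_eq continuous_intros)

lemma subspace_null_space: "subspace (null_space A)"
  by (rule subspaceI) (auto simp: null_space_def blinfun.add_right blinfun.scaleR_right)

lemma subspace_range: "subspace (range (blinfun_apply A))"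
  by (rule linear_subspace_image[OF bounded_linear.linear[OF blinfun.bounded_linear_right]
        subspace_UNIV])

sublocale null: chebyshev_subspace "null_space A"
  using reflexive_X strict_X closed_null_space subspace_null_space by unfold_locales

sublocale rng: chebyshev_subspace "closure (range (blinfun_apply A))"
  using reflexive_Y strict_Y subspace_range by unfold_locales (auto intro: subspace_closure)

lemma apply_in_closure_range: "blinfun_apply A x \<in> closure (range (blinfun_apply A))"
  by (rule subsetD[OF closure_subset rangeI])

lemma apply_proj_null [simp]: "blinfun_apply A (proj_null A x) = 0"
  using null.metric_proj_in by (simp add: proj_null_def null_space_def)

lemma proj_null_idem [simp]: "proj_null A (proj_null A x) = proj_null A x"
  by (simp add: proj_null_def null.metric_proj_of_mem null.metric_proj_in)

lemma proj_range_of_mem: "y \<in> closure (range (blinfun_apply A)) \<Longrightarrow> proj_range A y = y"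
  by (simp add: proj_range_def rng.metric_proj_of_mem)

lemma proj_range_apply [simp]: "proj_range A (blinfun_apply A x) = blinfun_apply A x"
  by (intro proj_range_of_mem apply_in_closure_range)

lemma proj_range_in: "proj_range A y \<in> closure (range (blinfun_apply A))"
  by (simp add: proj_range_def rng.metric_proj_in)

lemma proj_range_idem [simp]: "proj_range A (proj_range A y) = proj_range A y"
  by (intro proj_range_of_mem proj_range_in)

lemma proj_range_residual [simp]: "proj_range A (residual A F y) = residual A F y"
  unfolding residual_def
  by (intro proj_range_of_mem subspace_diff[OF rng.subspace] proj_range_in
      apply_in_closure_range)

lemma proj_null_diff: "proj_null A (x - z) = proj_null A x - proj_null A z"
  by (rule linear_diff[OF linear_proj_null])

lemma proj_null_add: "proj_null A (x + z) = proj_null A x + proj_null A z"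
  by (rule linear_add[OF linear_proj_null])

lemma CX_iff: "x \<in> CX A \<longleftrightarrow> proj_null A x = 0"
  by (simp add: CX_def proj_null_def null.duality_map_annihilates_iff[OF duality_X])

lemma CY_iff: "y \<in> CY A \<longleftrightarrow> proj_range A y = 0"
  using rng.duality_map_annihilates_iff[OF duality_Y]
  by (simp add: CY_def proj_range_def annihilator_closure)

text \<open>For \<open>y = A x + c\<close> with \<open>c\<close> in \<open>CY A\<close> the projection of \<open>y\<close> is \<open>A x\<close>, and
  \<open>x - proj_null A x\<close> is a preimage of it in \<open>CX A\<close>. Any such preimage has the two properties,
  whichever one the inverse selects.\<close>

lemma metric_ginv:
  assumes y: "y \<in> ginv_domain A"
  shows proj_null_metric_ginv: "proj_null A (metric_ginv A y) = 0"
    and apply_metric_ginv: "blinfun_apply A (metric_ginv A y) = proj_range A y"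
proof -
  obtain x c where xc: "y = blinfun_apply A x + c" "c \<in> CY A"
    using y by (auto simp: ginv_domain_def)
  have "proj_range A y = blinfun_apply A x"
    using xc rng.metric_proj_add[OF apply_in_closure_range, of x c]
    by (simp add: CY_iff proj_range_def)
  then have "proj_range A y = blinfun_apply A (x - proj_null A x)"
    by (simp add: blinfun.diff_right)
  moreover have "x - proj_null A x \<in> CX A"
    by (simp add: CX_iff proj_null_diff)
  ultimately have "proj_range A y \<in> blinfun_apply A ` CX A"
    by blast
  from inv_into_into[OF this] f_inv_into_f[OF this]
  show "proj_null A (metric_ginv A y) = 0"
    "blinfun_apply A (metric_ginv A y) = proj_range A y"
    by (simp_all add: metric_ginv_def CX_iff)
qed

lemma homogeneous_residual:
  assumes "homogeneous F"
  shows "homogeneous (residual A F)"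
  using assms rng.homogeneous_metric_proj
  by (simp add: homogeneous_def residual_def proj_range_def blinfun.scaleR_right scaleR_diff_right)

lemma homogeneous_left_residual:
  assumes "homogeneous F"
  shows "homogeneous (left_residual A F)"
  using assms null.homogeneous_metric_proj
  by (simp add: homogeneous_def left_residual_def proj_null_def blinfun.scaleR_right
      scaleR_diff_right)

lemma smallness_imp_approximate_inverse:
  assumes "homogeneous X0" "smallness_condition A X0"
  obtains q where "0 < q" "q < 1" "approximate_inverse A q X0"
proof -
  obtain q where q: "0 < q" "q < 1"
    and le: "\<And>x y. norm x \<le> 1 \<Longrightarrow> norm y \<le> 1 \<Longrightarrow>
      norm (left_residual A X0 x) \<le> q \<and> norm (residual A X0 y) \<le> q"
    using assms(2) by (auto simp: smallness_condition_def left_residual_def residual_def)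
  have "norm (left_residual A X0 x) \<le> q * norm x" for x
    using le[of _ 0] by (intro homogeneous_norm_bound homogeneous_left_residual assms(1)) simp
  moreover have "norm (residual A X0 y) \<le> q * norm y" for y
    using le[of 0] by (intro homogeneous_norm_bound homogeneous_residual assms(1)) simp
  ultimately have "approximate_inverse A q X0"
    using assms by (simp add: approximate_inverse_def smallness_condition_def)
  with q show thesis by (rule that)
qed

text \<open>The residual \<open>r\<close> of \<open>F\<close> lies in the closure of the range, so \<open>r = proj_range A r\<close>, and
  \<open>r - A (G r)\<close> is the residual of \<open>G\<close> at \<open>r\<close>.\<close>

lemma residual_corrected: "residual A (corrected A G F) y = residual A G (residual A F y)"
proof -
  have "residual A (corrected A G F) y = residual A F y - blinfun_apply A (G (residual A F y))"
    by (simp add: residual_def[of A "corrected A G F"] residual_def[of A F] corrected_def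
        blinfun.add_right)
  then show ?thesis
    by (simp add: residual_def[of A G])
qed

text \<open>Here the linearity of \<open>proj_null A\<close> enters: as it vanishes on the values of \<open>F\<close>, it also
  vanishes on the left residual of \<open>F\<close>, while \<open>A\<close> maps it to the residual of \<open>F\<close> at \<open>A x\<close>.\<close>

lemma left_residual_corrected:
  assumes "\<And>y. proj_null A (F y) = 0"
  shows "left_residual A (corrected A G F) x = left_residual A G (left_residual A F x)"
proof -
  have "proj_null A (left_residual A F x) = 0"
    by (simp add: left_residual_def proj_null_diff assms)
  moreover have "blinfun_apply A (left_residual A F x) = residual A F (blinfun_apply A x)"
    by (simp add: left_residual_def residual_def blinfun.diff_right)
  ultimately show ?thesis
    by (simp add: left_residual_def[of A "corrected A G F"] left_residual_def[of A G]
        left_residual_def[of A F] corrected_def)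
qed

text \<open>Both residuals of the corrected mapping are compositions of those of \<open>G\<close> and \<open>F\<close>, so the
  error bounds multiply.\<close>

lemma approximate_inverse_corrected:
  assumes F: "approximate_inverse A q F" and G: "approximate_inverse A r G" and r: "0 \<le> r"
  shows "approximate_inverse A (r * q) (corrected A G F)"
proof -
  have hom: "homogeneous F" "homogeneous G"
    and null: "\<And>y. proj_null A (F y) = 0" "\<And>y. proj_null A (G y) = 0"
    and proj: "\<And>y. F (proj_range A y) = F y"
    and left: "\<And>x. norm (left_residual A F x) \<le> q * norm x"
      "\<And>x. norm (left_residual A G x) \<le> r * norm x"
    and right: "\<And>y. norm (residual A F y) \<le> q * norm y"
      "\<And>y. norm (residual A G y) \<le> r * norm y"
    using F G by (auto simp: approximate_inverse_def)
  have "homogeneous (corrected A G F)"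
    using hom homogeneous_residual[OF hom(1)]
    by (simp add: homogeneous_def corrected_def scaleR_add_right)
  moreover have "proj_null A (corrected A G F y) = 0" for y
    by (simp add: corrected_def proj_null_add null)
  moreover have "corrected A G F (proj_range A y) = corrected A G F y" for y
    by (simp add: corrected_def residual_def proj)
  moreover have "norm (left_residual A (corrected A G F) x) \<le> r * q * norm x" for x
    using left(2)[of "left_residual A F x"] mult_left_mono[OF left(1)[of x] r]
    by (simp add: left_residual_corrected[OF null(1)] mult.assoc)
  moreover have "norm (residual A (corrected A G F) y) \<le> r * q * norm y" for y
    using right(2)[of "residual A F y"] mult_left_mono[OF right(1)[of y] r]
    by (simp add: residual_corrected mult.assoc)
  ultimately show ?thesis
    by (simp add: approximate_inverse_def)
qed

lemma sequential_regularization_if_rates_vanish: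
  assumes X: "\<And>k. approximate_inverse A (q k) (X k)" and q: "q \<longlonglongrightarrow> 0"
  shows "sequential_regularization A X"
  unfolding sequential_regularization_def
proof (intro conjI allI ballI)
  have vanish: "e \<longlonglongrightarrow> 0" if "\<And>k. norm (e k) \<le> q k * c" for e :: "nat \<Rightarrow> 'c::real_normed_vector" and c
    using tendsto_mult_left_zero[OF q, of c] that
    by (intro Lim_null_comparison[of e "\<lambda>k. q k * c"]) auto
  show "homogeneous (X k)" for k
    using X by (simp add: approximate_inverse_def)
  show "(\<lambda>k. blinfun_apply A (X k y)) \<longlonglongrightarrow> proj_range A y" for y
  proof -
    have "(\<lambda>k. residual A (X k) y) \<longlonglongrightarrow> 0"
      using X by (intro vanish[of _ "norm y"]) (auto simp: approximate_inverse_def)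
    then have "(\<lambda>k. proj_range A y - residual A (X k) y) \<longlonglongrightarrow> proj_range A y - 0"
      by (intro tendsto_diff tendsto_const)
    then show ?thesis
      by (simp add: residual_def)
  qed
  show "(\<lambda>k. X k y) \<longlonglongrightarrow> metric_ginv A y" if y: "y \<in> ginv_domain A" for y
  proof -
    let ?x = "metric_ginv A y"
    have "X k y = ?x - left_residual A (X k) ?x" for k
      using X by (simp add: left_residual_def metric_ginv[OF y] approximate_inverse_def)
    moreover have "(\<lambda>k. left_residual A (X k) ?x) \<longlonglongrightarrow> 0"
      using X by (intro vanish[of _ "norm ?x"]) (auto simp: approximate_inverse_def)
    then have "(\<lambda>k. ?x - left_residual A (X k) ?x) \<longlonglongrightarrow> ?x - 0"
      by (intro tendsto_diff tendsto_const)
    ultimately show ?thesis by simp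
  qed
qed

lemma approximate_inverse_schulz_newton:
  assumes "approximate_inverse A q X0" "0 \<le> q"
  shows "approximate_inverse A (q ^ 2 ^ k) (schulz_newton A X0 k)"
proof (induction k)
  case 0
  then show ?case using assms(1) by simp
next
  case (Suc k)
  have "schulz_newton A X0 (Suc k) = corrected A (schulz_newton A X0 k) (schulz_newton A X0 k)"
    by (simp add: fun_eq_iff corrected_def)
  with approximate_inverse_corrected[OF Suc Suc] assms(2) show ?case
    by (simp add: mult_2 power_add)
qed

text \<open>The mapping \<open>\<mu> B\<close> applied to the residual is \<open>X0\<close> itself, so every step contributes one
  factor \<open>q\<close>.\<close>

lemma approximate_inverse_landweber:
  assumes "approximate_inverse A q X0" "0 \<le> q" and X0: "X0 = (\<lambda>y. \<mu> *\<^sub>R landweber_B A y)"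
  shows "approximate_inverse A (q ^ Suc k) (landweber A \<mu> X0 k)"
proof (induction k)
  case 0
  then show ?case using assms(1) by simp
next
  case (Suc k)
  have "landweber A \<mu> X0 (Suc k) = corrected A X0 (landweber A \<mu> X0 k)"
    using X0 by (simp add: fun_eq_iff corrected_def)
  with approximate_inverse_corrected[OF Suc assms(1,2)] show ?case
    by simp
qed

end

theorem theorem2:
  fixes A :: "'a::banach \<Rightarrow>\<^sub>L 'b::banach"
    and X0 :: "'b \<Rightarrow> 'a"
  assumes "reflexive_space TYPE('a)" and "strictly_convex_space TYPE('a)"
    and "reflexive_space TYPE('b)" and "strictly_convex_space TYPE('b)"
    and "duality_single_valued TYPE('a)" and "duality_single_valued TYPE('b)"
    and "linear (proj_null A)"
    and "homogeneous X0"
    and "smallness_condition A X0"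
  shows "sequential_regularization A (schulz_newton A X0) \<and>
    (\<forall>\<mu>>0. X0 = (\<lambda>y. \<mu> *\<^sub>R landweber_B A y) \<longrightarrow>
       sequential_regularization A (landweber A \<mu> X0))"
proof -
  interpret generalized_inverse_setting A
    by (rule generalized_inverse_setting.intro[OF assms(1-7)])
  obtain q where q: "0 < q" "q < 1" and X0: "approximate_inverse A q X0"
    using smallness_imp_approximate_inverse[OF assms(8,9)] by blast
  have pow: "(\<lambda>k. q ^ k) \<longlonglongrightarrow> 0"
    using q by (intro LIMSEQ_power_zero) simp
  have "(\<lambda>k. q ^ 2 ^ k) \<longlonglongrightarrow> 0"
    using LIMSEQ_subseq_LIMSEQ[OF pow, of "\<lambda>k. 2 ^ k"]
    by (simp add: strict_mono_def comp_def)
  then have "sequential_regularization A (schulz_newton A X0)"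
    using approximate_inverse_schulz_newton[OF X0] q
    by (intro sequential_regularization_if_rates_vanish) auto
  moreover have "(\<lambda>k. q ^ Suc k) \<longlonglongrightarrow> 0"
    by (rule LIMSEQ_Suc[OF pow])
  then have "sequential_regularization A (landweber A \<mu> X0)"
    if "X0 = (\<lambda>y. \<mu> *\<^sub>R landweber_B A y)" for \<mu>
    using sequential_regularization_if_rates_vanish[OF approximate_inverse_landweber[OF X0 _ that]]
      q by simp
  ultimately show ?thesis by blast
qed

end
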